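(* Let $k$ be an algebraically closed field of characteristic $\neq 2$, let $V$ be a $7$-dimensional $k$-vector space, let $\gamma:\bigwedge^3 V\to k$ be a nondegenerate alternating trilinear form, and let $\beta$ be a nondegenerate symmetric bilinear form on $V$ compatible with $\gamma$. For any nonzero ($\gamma$-)isotropic vector $u\in V$, the space $$E_u=\{v\in V \mid \langle u,v\rangle \text{ is } \gamma\text{-isotropic}\}$$ is three-dimensional and $\beta$-isotropic. Moreover, every two-dimensional $\gamma$-isotropic subspace of $E_u$ contains $u$.
   Context: Angle brackets denote linear span. For a nondegenerate symmetric bilinear form $\beta$ on $V$, write $\phi\mapsto\phi^\dagger$ for the inverse $V^*\to V$ of the isomorphism $V\to V^*$, $v\mapsto\beta(v,\cdot)$. An alternating trilinear form $\gamma$ and a nondegenerate symmetric bilinear form $\beta$ are called compatible if $2\,\gamma(u,v,\gamma(u,v,\cdot)^\dagger)=\beta(u,u)\beta(v,v)-\beta(u,v)^2$ for all $u,v\in V$; $\gamma$ is called nondegenerate if some nondegenerate symmetric bilinear form is compatible with it (such a form is then unique up to scalar). A subspace $F\subset V$ of dimension at least $2$ is $\gamma$-isotropic if $\gamma(u,v,\cdot)\equiv 0$ for all $u,v\in F$; a vector or a $1$-dimensional subspace is $\gamma$-isotropic if it is contained in a $2$-dimensional $\gamma$-isotropic subspace. A subspace is $\beta$-isotropic if $\beta$ restricts to zero on it. *)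

theory Defs
  imports "HOL-Computational_Algebra.Polynomial"
begin

text \<open>The scalar multiplication is an explicit parameter, as in the locale vector_space.\<close>

definition symmetric_bilinear_form ::
  "('k::field \<Rightarrow> 'v::ab_group_add \<Rightarrow> 'v) \<Rightarrow> ('v \<Rightarrow> 'v \<Rightarrow> 'k) \<Rightarrow> bool" where
  "symmetric_bilinear_form scale \<beta> \<longleftrightarrow>
     (\<forall>u. Vector_Spaces.linear scale (*) (\<beta> u)) \<and> (\<forall>u v. \<beta> u v = \<beta> v u)"

definition nondegenerate_bilinear_form :: "('v::zero \<Rightarrow> 'v \<Rightarrow> 'k::zero) \<Rightarrow> bool" where
  "nondegenerate_bilinear_form \<beta> \<longleftrightarrow> (\<forall>v. (\<forall>w. \<beta> v w = 0) \<longrightarrow> v = 0)"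

text \<open>A linear form on the third exterior power of the space, given as the corresponding
  alternating trilinear map.\<close>

definition alternating_trilinear_form ::
  "('k::field \<Rightarrow> 'v::ab_group_add \<Rightarrow> 'v) \<Rightarrow> ('v \<Rightarrow> 'v \<Rightarrow> 'v \<Rightarrow> 'k) \<Rightarrow> bool" where
  "alternating_trilinear_form scale \<gamma> \<longleftrightarrow>
     (\<forall>v w. Vector_Spaces.linear scale (*) (\<lambda>u. \<gamma> u v w)) \<and>
     (\<forall>u w. Vector_Spaces.linear scale (*) (\<lambda>v. \<gamma> u v w)) \<and>
     (\<forall>u v. Vector_Spaces.linear scale (*) (\<lambda>w. \<gamma> u v w)) \<and>
     (\<forall>u w. \<gamma> u u w = 0) \<and> (\<forall>u v. \<gamma> u v v = 0) \<and> (\<forall>u v. \<gamma> u v u = 0)"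

text \<open>The inverse of the map \<open>v \<mapsto> \<beta>(v, \<cdot>)\<close>. It is meaningful on linear forms only, and only if
  the space is finite-dimensional and \<open>\<beta>\<close> is bilinear and nondegenerate, so that this map is
  an isomorphism onto the dual space.\<close>

definition dagger :: "('v \<Rightarrow> 'v \<Rightarrow> 'k) \<Rightarrow> ('v \<Rightarrow> 'k) \<Rightarrow> 'v" where
  "dagger \<beta> \<phi> = inv \<beta> \<phi>"

definition compatible_forms :: "('v \<Rightarrow> 'v \<Rightarrow> 'v \<Rightarrow> 'k::field) \<Rightarrow> ('v \<Rightarrow> 'v \<Rightarrow> 'k) \<Rightarrow> bool" where
  "compatible_forms \<gamma> \<beta> \<longleftrightarrow>
     (\<forall>u v. 2 * \<gamma> u v (dagger \<beta> (\<gamma> u v)) = \<beta> u u * \<beta> v v - (\<beta> u v)\<^sup>2)"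

definition nondegenerate_trilinear_form ::
  "('k::field \<Rightarrow> 'v::ab_group_add \<Rightarrow> 'v) \<Rightarrow> ('v \<Rightarrow> 'v \<Rightarrow> 'v \<Rightarrow> 'k) \<Rightarrow> bool" where
  "nondegenerate_trilinear_form scale \<gamma> \<longleftrightarrow>
     (\<exists>\<beta>. symmetric_bilinear_form scale \<beta> \<and> nondegenerate_bilinear_form \<beta> \<and> compatible_forms \<gamma> \<beta>)"

text \<open>Isotropy with respect to \<open>\<gamma>\<close> has a separate meaning for lines (and vectors): there the
  condition \<open>\<gamma>(u, v, \<cdot>) = 0\<close> would hold trivially. The zero subspace is not
  called isotropic.\<close>

definition gamma_isotropic_plane ::
  "('k::field \<Rightarrow> 'v::ab_group_add \<Rightarrow> 'v) \<Rightarrow> ('v \<Rightarrow> 'v \<Rightarrow> 'v \<Rightarrow> 'k) \<Rightarrow> 'v set \<Rightarrow> bool" where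
  "gamma_isotropic_plane scale \<gamma> F \<longleftrightarrow>
     module.subspace scale F \<and> vector_space.dim scale F = 2 \<and> (\<forall>u\<in>F. \<forall>v\<in>F. \<forall>w. \<gamma> u v w = 0)"

definition gamma_isotropic ::
  "('k::field \<Rightarrow> 'v::ab_group_add \<Rightarrow> 'v) \<Rightarrow> ('v \<Rightarrow> 'v \<Rightarrow> 'v \<Rightarrow> 'k) \<Rightarrow> 'v set \<Rightarrow> bool" where
  "gamma_isotropic scale \<gamma> F \<longleftrightarrow> module.subspace scale F \<and>
     (vector_space.dim scale F \<ge> 2 \<and> (\<forall>u\<in>F. \<forall>v\<in>F. \<forall>w. \<gamma> u v w = 0) \<or>
      vector_space.dim scale F = 1 \<and> (\<exists>P. gamma_isotropic_plane scale \<gamma> P \<and> F \<subseteq> P))"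

definition gamma_isotropic_vector ::
  "('k::field \<Rightarrow> 'v::ab_group_add \<Rightarrow> 'v) \<Rightarrow> ('v \<Rightarrow> 'v \<Rightarrow> 'v \<Rightarrow> 'k) \<Rightarrow> 'v \<Rightarrow> bool" where
  "gamma_isotropic_vector scale \<gamma> u \<longleftrightarrow> (\<exists>P. gamma_isotropic_plane scale \<gamma> P \<and> u \<in> P)"

definition beta_isotropic ::
  "('k::field \<Rightarrow> 'v::ab_group_add \<Rightarrow> 'v) \<Rightarrow> ('v \<Rightarrow> 'v \<Rightarrow> 'k) \<Rightarrow> 'v set \<Rightarrow> bool" where
  "beta_isotropic scale \<beta> F \<longleftrightarrow> module.subspace scale F \<and> (\<forall>u\<in>F. \<forall>v\<in>F. \<beta> u v = 0)"

definition E_space ::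
  "('k::field \<Rightarrow> 'v::ab_group_add \<Rightarrow> 'v) \<Rightarrow> ('v \<Rightarrow> 'v \<Rightarrow> 'v \<Rightarrow> 'k) \<Rightarrow> 'v \<Rightarrow> 'v set" where
  "E_space scale \<gamma> u = {v. gamma_isotropic scale \<gamma> (module.span scale {u, v})}"

end

theory Submission
  imports Defs
begin

text \<open>
  Write \<open>a \<times> b\<close> for the vector \<open>\<gamma>(a, b, \<cdot>)\<^sup>\<dagger>\<close>, so that \<open>\<beta>(a \<times> b, c) = \<gamma>(a, b, c)\<close>.
  Then \<open>\<gamma>\<close> and \<open>\<beta>\<close> are compatible precisely when \<open>\<times>\<close> is, up to the factor 2, a cross product
  of the kind found on the imaginary octonions; polarizing the compatibility condition gives the
  double product formula \<open>2 a \<times> (a \<times> b) = \<beta>(a, b) a - \<beta>(a, a) b\<close> (\<open>cross_cross\<close>), and the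
  whole argument is a calculation with this identity and its polarization.

  Let \<open>u\<close> be nonzero and isotropic and let \<open>A\<close> be the linear map \<open>v \<mapsto> u \<times> v\<close>. The space
  \<open>E\<^sub>u\<close> is the kernel of \<open>A\<close>. Since this kernel is not just the line of \<open>u\<close>, the formula
  forces \<open>\<beta>(u, u) = 0\<close>, and then that the kernel is orthogonal to \<open>u\<close> and \<open>\<beta>\<close>-isotropic.

  The dimension comes from rank and nullity alone. On the one hand \<open>2 A\<^sup>2 v = \<beta>(u, v) u\<close>, so \<open>A\<close>
  maps its image into a line, and the rank is at most one more than the nullity. On the other hand
  the kernel lies in the image: if \<open>\<beta>(u, x) = 1\<close>, then \<open>2 v = 2 u \<times> (v \<times> x) + \<beta>(v, x) u\<close> for
  every \<open>v\<close> in the kernel, and \<open>u\<close> itself is \<open>2 A\<^sup>2 x\<close>. So the nullity is half of the dimension,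
  rounded down, which is 3 in dimension 7 (\<open>dim_cross_kernel\<close>).

  Finally suppose that an isotropic plane \<open>\<langle>v, w\<rangle>\<close> in \<open>E\<^sub>u\<close> misses \<open>u\<close>. Then \<open>u, v, w\<close> is a basis
  of \<open>E\<^sub>u\<close> and all products in \<open>E\<^sub>u\<close> vanish. But for \<open>x\<close> orthogonal to \<open>u\<close> and \<open>v\<close> and not to \<open>w\<close>
  the vector \<open>v \<times> x\<close> lies in \<open>E\<^sub>u\<close>, whereas \<open>w \<times> (v \<times> x) = \<beta>(w, x) v\<close> is not zero
  (\<open>in_span_if_cross_vanishes_on_kernel\<close>).
\<close>

section \<open>Rank and nullity\<close>

lemma (in vector_space) span_Int_trivial_of_independent_Un:
  assumes ind: "independent (B \<union> D)" and disj: "B \<inter> D = {}"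
    and x: "x \<in> span B" "x \<in> span D"
  shows "x = 0"
proof -
  have B: "representation (B \<union> D) x = representation B x"
    by (rule representation_extend[OF ind x(1)]) auto
  have D: "representation (B \<union> D) x = representation D x"
    by (rule representation_extend[OF ind x(2)]) auto
  have "representation (B \<union> D) x b = 0" for b
  proof (rule ccontr)
    assume nz: "representation (B \<union> D) x b \<noteq> 0"
    have "b \<in> B" using nz unfolding B by (rule representation_ne_zero)
    moreover have "b \<in> D" using nz unfolding D by (rule representation_ne_zero)
    ultimately show False using disj by blast
  qed
  moreover have "x \<in> span (B \<union> D)"
    using x(1) span_mono[of B "B \<union> D"] by blast
  ultimately show ?thesis
    using sum_nonzero_representation_eq[OF ind, of x] by simp
qed

text \<open>Extend a basis of the kernel to a basis of \<open>S\<close>; \<open>f\<close> is injective on the span of the added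
  vectors and maps it onto all of \<open>f ` S\<close>.\<close>

lemma (in finite_dimensional_vector_space_pair_1) rank_plus_nullity:
  assumes f: "Vector_Spaces.linear s1 s2 f" and S: "vs1.subspace S"
  shows "vs2.dim (f ` S) + vs1.dim {x \<in> S. f x = 0} = vs1.dim S"
proof -
  let ?K = "{x \<in> S. f x = 0}"
  interpret f: Vector_Spaces.linear s1 s2 f by (rule f)
  have K: "vs1.subspace ?K"
    using vs1.subspace_inter[OF S f.subspace_kernel] by (simp add: Int_def)
  obtain B where B: "B \<subseteq> ?K" "vs1.independent B" "?K \<subseteq> vs1.span B" "card B = vs1.dim ?K"
    using vs1.basis_exists by blast
  obtain C where C: "B \<subseteq> C" "C \<subseteq> S" "vs1.independent C" "S \<subseteq> vs1.span C"
    using vs1.maximal_independent_subset_extend[of B S] B by blast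
  define D where "D = C - B"
  have Ceq: "C = B \<union> D" "B \<inter> D = {}" using C(1) by (auto simp: D_def)
  have finC: "finite C" using C(3) vs1.finiteI_independent by blast
  have indD: "vs1.independent D"
    using C(3) vs1.independent_mono by (auto simp: D_def)
  have spanD: "vs1.span D \<subseteq> S"
    using C(2) by (intro vs1.span_minimal S) (auto simp: D_def)
  have "inj_on f (vs1.span D)"
    unfolding f.inj_on_iff_eq_0[OF vs1.subspace_span]
  proof (intro ballI impI)
    fix x assume x: "x \<in> vs1.span D" "f x = 0"
    then have "x \<in> vs1.span B" using spanD B(3) by blast
    then show "x = 0"
      using vs1.span_Int_trivial_of_independent_Un[of B D] C(3) Ceq x(1) by auto
  qed
  then have "vs2.dim (f ` vs1.span D) = card D"
    using dim_image_eq[OF f, of "vs1.span D"] indD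
    by (simp add: vs1.span_span vs1.dim_eq_card_independent)
  moreover have "f ` S = f ` vs1.span D"
  proof
    show "f ` S \<subseteq> f ` vs1.span D"
    proof
      fix y assume "y \<in> f ` S"
      then obtain x where x: "x \<in> S" "y = f x" by blast
      then obtain b d where bd: "x = b + d" "b \<in> vs1.span B" "d \<in> vs1.span D"
        using C(4) unfolding Ceq vs1.span_Un by blast
      have "b \<in> ?K" using bd(2) vs1.span_minimal[OF B(1) K] by blast
      then have "y = f d" using x bd by (simp add: f.add)
      then show "y \<in> f ` vs1.span D" using bd by blast
    qed
  qed (use spanD in blast)
  moreover have "card C = vs1.dim S"
    using C by (intro vs1.basis_card_eq_dim)
  moreover have "card C = card B + card D"
    using finC Ceq by (auto intro: card_Un_disjoint)
  ultimately show ?thesis using B(4) by simp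
qed

section \<open>Nondegenerate symmetric forms\<close>

locale nondegenerate_symmetric_space = vector_space scale
  for scale :: "'k::field \<Rightarrow> 'v::ab_group_add \<Rightarrow> 'v" +
  fixes \<beta> :: "'v \<Rightarrow> 'v \<Rightarrow> 'k"
  assumes symmetric: "symmetric_bilinear_form scale \<beta>"
    and nondegenerate: "nondegenerate_bilinear_form \<beta>"
begin

lemma \<beta>_commute: "\<beta> a b = \<beta> b a"
  using symmetric by (auto simp: symmetric_bilinear_form_def)

lemma \<beta>_linear: "Vector_Spaces.linear scale (*) (\<beta> a)"
  using symmetric by (auto simp: symmetric_bilinear_form_def)

lemma \<beta>_right [simp]:
  "\<beta> a (b + c) = \<beta> a b + \<beta> a c" "\<beta> a (scale r b) = r * \<beta> a b"
  "\<beta> a 0 = 0" "\<beta> a (b - c) = \<beta> a b - \<beta> a c" "\<beta> a (- b) = - \<beta> a b"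
proof -
  interpret Vector_Spaces.linear scale "(*)" "\<beta> a" by (rule \<beta>_linear)
  show "\<beta> a (b + c) = \<beta> a b + \<beta> a c" "\<beta> a (scale r b) = r * \<beta> a b"
    "\<beta> a 0 = 0" "\<beta> a (b - c) = \<beta> a b - \<beta> a c" "\<beta> a (- b) = - \<beta> a b"
    by (simp_all add: add scale diff neg)
qed

lemma \<beta>_left [simp]:
  "\<beta> (b + c) a = \<beta> b a + \<beta> c a" "\<beta> (scale r b) a = r * \<beta> b a"
  "\<beta> 0 a = 0" "\<beta> (b - c) a = \<beta> b a - \<beta> c a" "\<beta> (- b) a = - \<beta> b a"
  by (simp_all add: \<beta>_commute[of _ a])

lemma eqI_\<beta>:
  assumes "\<And>w. \<beta> a w = \<beta> b w"
  shows "a = b"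
proof -
  have "\<forall>w. \<beta> (a - b) w = 0" using assms by simp
  then have "a - b = 0" using nondegenerate unfolding nondegenerate_bilinear_form_def by blast
  then show ?thesis by simp
qed

text \<open>The double orthogonal complement of a finite set is its span, in any dimension. If some
  \<open>y\<close> orthogonal to \<open>S\<close> is not orthogonal to the added vector \<open>a\<close>, then every \<open>x\<close> orthogonal to
  \<open>S\<close> can be corrected by a multiple of \<open>y\<close> to be orthogonal to \<open>a\<close> too, so subtracting a suitable
  multiple of \<open>a\<close> from \<open>w\<close> leads back to \<open>S\<close>; if there is no such \<open>y\<close>, orthogonality to \<open>a\<close> is
  no further constraint.\<close>

lemma in_span_if_orthogonal_to_perp:
  assumes "finite S" "\<And>x. (\<And>s. s \<in> S \<Longrightarrow> \<beta> s x = 0) \<Longrightarrow> \<beta> w x = 0"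
  shows "w \<in> span S"
  using assms
proof (induction S arbitrary: w rule: finite_induct)
  case empty
  have "w = 0" by (rule eqI_\<beta>) (use empty in auto)
  then show ?case by (simp add: span_zero)
next
  case (insert a S)
  show ?case
  proof (cases "\<exists>y. (\<forall>s\<in>S. \<beta> s y = 0) \<and> \<beta> a y \<noteq> 0")
    case True
    then obtain y where y: "\<And>s. s \<in> S \<Longrightarrow> \<beta> s y = 0" "\<beta> a y \<noteq> 0" by blast
    define c where "c = \<beta> w y / \<beta> a y"
    have "w - scale c a \<in> span S"
    proof (rule insert.IH)
      fix x assume x: "\<And>s. s \<in> S \<Longrightarrow> \<beta> s x = 0"
      define x' where "x' = x - scale (\<beta> a x / \<beta> a y) y"
      have "\<beta> w x' = 0"
        by (rule insert.prems) (use x y in \<open>auto simp: x'_def\<close>)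
      then show "\<beta> (w - scale c a) x = 0"
        using y(2) by (simp add: x'_def c_def field_simps)
    qed
    then show ?thesis by (auto simp: span_breakdown_eq)
  next
    case False
    have "w \<in> span S"
      by (rule insert.IH) (use False insert.prems in blast)
    then show ?thesis using span_mono[of S "insert a S"] by blast
  qed
qed

text \<open>This makes the map \<open>v \<mapsto> \<beta>(v, \<cdot>)\<close> onto the dual space in finite dimension, so that
  \<^const>\<open>dagger\<close> inverts it. A value at a new vector \<open>t\<close> can be adjusted without disturbing the
  values on \<open>S\<close>, because \<open>t\<close> is outside the double orthogonal complement of \<open>S\<close>.\<close>

lemma represents_on_independent:
  assumes "finite S" "independent S"
  shows "\<exists>a. \<forall>s\<in>S. \<beta> a s = f s"
  using assms
proof (induction S rule: finite_induct)
  case (insert t S)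
  have "independent S" using insert.prems by (rule independent_mono) auto
  then obtain a where a: "\<forall>s\<in>S. \<beta> a s = f s" using insert.IH by blast
  have "t \<notin> span S" using insert.prems insert.hyps(2) by (simp add: independent_insert)
  then obtain c where c: "\<And>s. s \<in> S \<Longrightarrow> \<beta> s c = 0" "\<beta> t c \<noteq> 0"
    using in_span_if_orthogonal_to_perp[OF insert.hyps(1), of t] by blast
  define a' where "a' = a + scale ((f t - \<beta> a t) / \<beta> t c) c"
  have "\<beta> a' t = f t"
    using c(2) by (simp add: a'_def \<beta>_commute[of c])
  moreover have "\<forall>s\<in>S. \<beta> a' s = f s"
    using a c(1) by (simp add: a'_def \<beta>_commute[of c])
  ultimately show ?case by blast
qed simp

end

section \<open>The cross product of a compatible pair\<close>

locale compatible_pair = nondegenerate_symmetric_space scale \<beta> +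
  finite_dimensional_vector_space scale Basis
  for scale :: "'k::field \<Rightarrow> 'v::ab_group_add \<Rightarrow> 'v" and \<beta> Basis +
  fixes \<gamma> :: "'v \<Rightarrow> 'v \<Rightarrow> 'v \<Rightarrow> 'k"
  assumes alternating: "alternating_trilinear_form scale \<gamma>"
    and compatible: "compatible_forms \<gamma> \<beta>"
    and two_neq_0: "(2 :: 'k) \<noteq> 0"
begin

definition cross :: "'v \<Rightarrow> 'v \<Rightarrow> 'v" where
  "cross a b = dagger \<beta> (\<gamma> a b)"

lemma \<beta>_cross: "\<beta> (cross a b) c = \<gamma> a b c"
proof -
  obtain d where d: "\<forall>s\<in>Basis. \<beta> d s = \<gamma> a b s"
    using represents_on_independent[OF finite_Basis independent_Basis] by blast
  have lin: "Vector_Spaces.linear scale (*) (\<gamma> a b)"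
    using alternating by (auto simp: alternating_trilinear_form_def)
  interpret pair: vector_space_pair scale "(*) :: 'k \<Rightarrow> 'k \<Rightarrow> 'k"
    using lin by (simp add: vector_space_pair_def Vector_Spaces.linear_def)
  have "\<beta> d = \<gamma> a b"
  proof
    fix x
    show "\<beta> d x = \<gamma> a b x"
      by (rule pair.linear_eq_on[OF \<beta>_linear lin, of _ Basis]) (use d span_Basis in auto)
  qed
  then have "\<beta> (cross a b) = \<gamma> a b"
    unfolding cross_def dagger_def by (metis f_inv_into_f rangeI)
  then show ?thesis by simp
qed

lemma \<gamma>_linear:
  "Vector_Spaces.linear scale (*) (\<lambda>a. \<gamma> a b c)"
  "Vector_Spaces.linear scale (*) (\<lambda>b. \<gamma> a b c)"
  "Vector_Spaces.linear scale (*) (\<lambda>c. \<gamma> a b c)"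
  using alternating by (auto simp: alternating_trilinear_form_def)

lemma \<gamma>_add:
  "\<gamma> (a + a') b c = \<gamma> a b c + \<gamma> a' b c"
  "\<gamma> a (b + b') c = \<gamma> a b c + \<gamma> a b' c"
  "\<gamma> a b (c + c') = \<gamma> a b c + \<gamma> a b c'"
  using \<gamma>_linear unfolding Vector_Spaces.linear_iff by blast+

lemma \<gamma>_scale:
  "\<gamma> (scale r a) b c = r * \<gamma> a b c"
  "\<gamma> a (scale r b) c = r * \<gamma> a b c"
  using \<gamma>_linear unfolding Vector_Spaces.linear_iff by blast+

lemma \<gamma>_self: "\<gamma> a a c = 0" "\<gamma> a b b = 0"
  using alternating by (auto simp: alternating_trilinear_form_def)

lemma \<gamma>_swap: "\<gamma> b a c = - \<gamma> a b c" "\<gamma> a c b = - \<gamma> a b c"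
proof -
  have "\<gamma> (a + b) (a + b) c = 0" by (rule \<gamma>_self)
  then show "\<gamma> b a c = - \<gamma> a b c"
    by (simp add: \<gamma>_add \<gamma>_self(1)[of a] \<gamma>_self(1)[of b] eq_neg_iff_add_eq_0 add.commute)
  have "\<gamma> a (b + c) (b + c) = 0" by (rule \<gamma>_self)
  then show "\<gamma> a c b = - \<gamma> a b c"
    by (simp add: \<gamma>_add \<gamma>_self(2)[of a b] \<gamma>_self(2)[of a c] eq_neg_iff_add_eq_0 add.commute)
qed

lemma cross_add:
  "cross (a + a') b = cross a b + cross a' b" "cross a (b + b') = cross a b + cross a b'"
  by (rule eqI_\<beta>; simp add: \<beta>_cross \<gamma>_add)+

lemma cross_scale:
  "cross (scale r a) b = scale r (cross a b)" "cross a (scale r b) = scale r (cross a b)"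
  by (rule eqI_\<beta>; simp add: \<beta>_cross \<gamma>_scale)+

lemma cross_linear: "Vector_Spaces.linear scale scale (cross a)"
  unfolding Vector_Spaces.linear_iff by (simp add: cross_add cross_scale vector_space_axioms)

lemma cross_self [simp]: "cross a a = 0"
  by (rule eqI_\<beta>) (simp add: \<beta>_cross \<gamma>_self)

lemma cross_swap: "cross b a = - cross a b"
  by (rule eqI_\<beta>) (simp add: \<beta>_cross \<gamma>_swap(1)[of b a])

lemma cross_eq_0_iff: "cross a b = 0 \<longleftrightarrow> (\<forall>c. \<gamma> a b c = 0)"
  by (metis \<beta>_cross \<beta>_left(3) eqI_\<beta>)

text \<open>The compatibility condition polarized in the second argument.\<close>

lemma \<beta>_cross_cross:
  "2 * \<beta> (cross a b) (cross a c) = \<beta> a a * \<beta> b c - \<beta> a b * \<beta> a c"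
proof -
  have norm: "2 * \<beta> (cross a d) (cross a d) = \<beta> a a * \<beta> d d - (\<beta> a d)\<^sup>2" for d
    using compatible \<beta>_cross[of a d "cross a d"]
    by (simp add: compatible_forms_def flip: cross_def)
  have "2 * (2 * \<beta> (cross a b) (cross a c)) = 2 * (\<beta> a a * \<beta> b c - \<beta> a b * \<beta> a c)"
    using norm[of "b + c"] norm[of b] norm[of c]
    by (simp add: cross_add \<beta>_commute[of c b] \<beta>_commute[of "cross a c" "cross a b"]
        algebra_simps power2_eq_square)
  then show ?thesis using two_neq_0 mult_left_cancel by blast
qed

text \<open>The adjoint of \<open>b \<mapsto> a \<times> b\<close> with respect to \<open>\<beta>\<close> is its negative, which turns the previous
  identity into a formula for the square of this map.\<close>

lemma cross_cross:
  "scale 2 (cross a (cross a b)) = scale (\<beta> a b) a - scale (\<beta> a a) b"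
proof (rule eqI_\<beta>)
  fix w
  have "\<beta> (cross a (cross a b)) w = - \<beta> (cross a b) (cross a w)"
    unfolding \<beta>_cross by (metis \<beta>_cross \<beta>_commute \<gamma>_swap(2))
  then show "\<beta> (scale 2 (cross a (cross a b))) w
      = \<beta> (scale (\<beta> a b) a - scale (\<beta> a a) b) w"
    using \<beta>_cross_cross[of a b w] by (simp add: algebra_simps)
qed

lemma cross_cross_polarized:
  "scale 2 (cross a (cross b c) + cross b (cross a c))
     = scale (\<beta> a c) b + scale (\<beta> b c) a - scale (2 * \<beta> a b) c"
proof -
  have norm: "scale (\<beta> (a + b) (a + b)) c
      = scale (\<beta> a a) c + scale (\<beta> b b) c + scale (2 * \<beta> a b) c"
  proof -
    have "\<beta> (a + b) (a + b) = \<beta> a a + \<beta> b b + 2 * \<beta> a b"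
      by (simp add: \<beta>_commute[of b a])
    then show ?thesis by (simp only: scale_left_distrib)
  qed
  have "scale 2 (cross a (cross b c) + cross b (cross a c))
      = scale 2 (cross (a + b) (cross (a + b) c))
        - scale 2 (cross a (cross a c)) - scale 2 (cross b (cross b c))"
    by (simp add: cross_add scale_right_distrib)
  also have "\<dots> = scale (\<beta> a c) b + scale (\<beta> b c) a - scale (2 * \<beta> a b) c"
    unfolding cross_cross norm by (simp add: scale_left_distrib scale_right_distrib)
  finally show ?thesis .
qed

text \<open>Once \<open>a \<times> b = 0\<close>, one of the two double products of \<open>a\<close>, \<open>x\<close> and \<open>b\<close> in the polarized
  formula drops out and the other is expressed by \<open>\<beta>\<close> alone.
  Both the dimension count and the last claim about planes rest on this.\<close>

lemma cross_cross_if_cross_eq_0: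
  assumes "cross a b = 0"
  shows "scale 2 (cross a (cross b x)) = scale (2 * \<beta> a x) b - scale (\<beta> b x) a - scale (\<beta> a b) x"
proof -
  interpret a: Vector_Spaces.linear scale scale "cross a" by (rule cross_linear)
  interpret x: Vector_Spaces.linear scale scale "cross x" by (rule cross_linear)
  have "scale 2 (cross a (cross x b)) = scale (\<beta> a b) x + scale (\<beta> b x) a - scale (2 * \<beta> a x) b"
    using cross_cross_polarized[of a x b] assms by (simp add: \<beta>_commute[of x b])
  then show ?thesis
    by (simp add: cross_swap[of b x] a.neg algebra_simps)
qed

lemma subspace_cross_kernel: "subspace {v. cross a v = 0}"
proof -
  interpret a: Vector_Spaces.linear scale scale "cross a" by (rule cross_linear)
  show ?thesis by (rule a.subspace_kernel)
qed

lemma cross_eq_0_on_span: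
  assumes S: "\<And>a b. a \<in> S \<Longrightarrow> b \<in> S \<Longrightarrow> cross a b = 0"
    and ab: "a \<in> span S" "b \<in> span S"
  shows "cross a b = 0"
proof -
  have right: "cross c d = 0" if "c \<in> S" "d \<in> span S" for c d
    using span_minimal[OF _ subspace_cross_kernel[of c], of S] S that by blast
  have "cross b c = 0" if "c \<in> S" for c
    using right[OF that ab(2)] cross_swap[of b c] by simp
  then have "cross b a = 0"
    using span_minimal[OF _ subspace_cross_kernel[of b], of S] ab(1) by blast
  then show ?thesis using cross_swap[of a b] by simp
qed

section \<open>The kernel of the cross product with a vector\<close>

text \<open>For vectors with \<open>u \<times> w = 0\<close> the double product formula reads
  \<open>\<beta>(u, u) w = \<beta>(u, w) u\<close>, which makes \<open>w\<close> a multiple of \<open>u\<close> unless \<open>u\<close> is null.\<close>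

lemma null_if_cross_eq_0:
  assumes "cross u w = 0" "w \<notin> span {u}"
  shows "\<beta> u u = 0"
proof (rule ccontr)
  assume nz: "\<beta> u u \<noteq> 0"
  interpret u: Vector_Spaces.linear scale scale "cross u" by (rule cross_linear)
  have "scale (\<beta> u u) w = scale (\<beta> u w) u"
    using cross_cross[of u w] assms(1) by simp
  then have "w = scale (\<beta> u w / \<beta> u u) u"
    using nz by (metis divide_inverse_commute scale_left_imp_eq scale_scale
        nonzero_mult_div_cancel_left times_divide_eq_right)
  then show False using assms(2) unfolding span_singleton by blast
qed

text \<open>In \<open>2 u \<times> (u \<times> v)\<close> and \<open>2 v \<times> (v \<times> u)\<close>, both zero, only one term of the double product
  formula is left, a multiple of \<open>u\<close>: the factor is \<open>\<beta>(u, v)\<close> in the first and \<open>- \<beta>(v, v)\<close> in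
  the second.\<close>

lemma cross_kernel_orthogonal:
  assumes u: "u \<noteq> 0" "\<beta> u u = 0" and v: "cross u v = 0"
  shows "\<beta> u v = 0" "\<beta> v v = 0"
proof -
  interpret u: Vector_Spaces.linear scale scale "cross u" by (rule cross_linear)
  interpret v: Vector_Spaces.linear scale scale "cross v" by (rule cross_linear)
  show uv: "\<beta> u v = 0" using cross_cross[of u v] u v by simp
  have "cross v u = 0" using v cross_swap[of v u] by simp
  then show "\<beta> v v = 0"
    using cross_cross[of v u] u uv by (simp add: \<beta>_commute[of v u])
qed

lemma cross_kernel_isotropic:
  assumes u: "u \<noteq> 0" "\<beta> u u = 0" and "cross u v = 0" "cross u w = 0"
  shows "\<beta> v w = 0"
proof -
  have "cross u (v + w) = 0" using assms by (simp add: cross_add)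
  from cross_kernel_orthogonal(2)[OF u this] have "2 * \<beta> v w = 0"
    using cross_kernel_orthogonal(2)[OF u] assms(3,4) by (simp add: \<beta>_commute[of w v])
  then show ?thesis using two_neq_0 by simp
qed

text \<open>With \<open>A v = u \<times> v\<close>, the image of \<open>A\<close> contains the kernel of \<open>A\<close> and is mapped by \<open>A\<close> into
  the line of \<open>u\<close>. So rank minus nullity is 0 or 1, while their sum is the dimension of the
  space.\<close>

lemma dim_cross_kernel:
  assumes u: "u \<noteq> 0" "\<beta> u u = 0"
  shows "dim {v. cross u v = 0} = dim UNIV div 2"
proof -
  let ?K = "{v. cross u v = 0}" and ?R = "range (cross u)"
  interpret u: Vector_Spaces.linear scale scale "cross u" by (rule cross_linear)
  interpret pair: finite_dimensional_vector_space_pair_1 scale Basis scale ..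
  have R: "subspace ?R" by (rule u.subspace_image) simp
  have n: "dim ?R + dim ?K = dim UNIV"
    using pair.rank_plus_nullity[OF cross_linear[of u] subspace_UNIV] by simp
  have half: "c = d" if "scale 2 c = scale 2 d" for c d
    using that two_neq_0 by simp

  \<comment> \<open>Lower bound on the nullity: the square of the map has rank at most 1.\<close>
  have "cross u ` ?R \<subseteq> span {u}"
  proof clarify
    fix x
    have "scale 2 (cross u (cross u x)) = scale 2 (scale (\<beta> u x / 2) u)"
      using cross_cross[of u x] u two_neq_0 by simp
    then show "cross u (cross u x) \<in> span {u}"
      using half span_scale[OF span_base[of u "{u}"]] by (metis singletonI)
  qed
  then have "dim (cross u ` ?R) \<le> 1"
    using dim_le_card[of "cross u ` ?R" "{u}"] by simp
  moreover have "dim {x \<in> ?R. cross u x = 0} \<le> dim ?K"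
    by (rule dim_subset) auto
  ultimately have low: "dim ?R \<le> 1 + dim ?K"
    using pair.rank_plus_nullity[OF cross_linear[of u] R] by linarith

  \<comment> \<open>Upper bound on the nullity: \<open>x\<close> yields a preimage for each vector of the kernel.\<close>
  obtain x where x: "\<beta> u x = 1"
  proof -
    obtain y where "\<beta> u y \<noteq> 0" using eqI_\<beta>[of u 0] u by auto
    then show ?thesis using that[of "scale (1 / \<beta> u y) y"] by simp
  qed
  have "?K \<subseteq> ?R"
  proof clarify
    fix v assume v: "cross u v = 0"
    have u_in: "u \<in> ?R"
    proof -
      have "u = cross u (cross u (scale 2 x))"
        using cross_cross[of u x] u x by (simp add: cross_scale)
      then show ?thesis by blast
    qed
    have "scale 2 v = scale 2 (cross u (cross v x)) + scale (\<beta> v x) u"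
      using cross_cross_if_cross_eq_0[OF v, of x] cross_kernel_orthogonal(1)[OF u v] x by simp
    moreover have "\<dots> \<in> ?R"
      by (intro subspace_add[OF R] subspace_scale[OF R] u_in rangeI)
    ultimately have "scale (1 / 2) (scale 2 v) \<in> ?R"
      using subspace_scale[OF R] by metis
    then show "v \<in> ?R" using two_neq_0 by simp
  qed
  then have "dim ?K \<le> dim ?R" by (rule dim_subset)
  with low n show ?thesis by linarith
qed

text \<open>If \<open>w\<close> were outside \<open>\<langle>u, v\<rangle>\<close>, some \<open>x\<close> orthogonal to \<open>u\<close> and \<open>v\<close> would satisfy
  \<open>\<beta>(w, x) \<noteq> 0\<close>. The vector \<open>v \<times> x\<close> is then in the kernel of \<open>u\<close>, hence in \<open>\<langle>u, v, w\<rangle>\<close>, all of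
  which \<open>w\<close> annihilates; yet \<open>w \<times> (v \<times> x) = \<beta>(w, x) v\<close>.\<close>

lemma in_span_if_cross_vanishes_on_kernel:
  assumes u: "u \<noteq> 0" "\<beta> u u = 0" and "v \<noteq> 0"
    and uv: "cross u v = 0" and uw: "cross u w = 0" and vw: "cross v w = 0"
    and K: "{x. cross u x = 0} \<subseteq> span {u, v, w}"
  shows "w \<in> span {u, v}"
proof (rule ccontr)
  assume "w \<notin> span {u, v}"
  then obtain x where x: "\<beta> u x = 0" "\<beta> v x = 0" "\<beta> w x \<noteq> 0"
    using in_span_if_orthogonal_to_perp[of "{u, v}" w] by auto
  have wu: "cross w u = 0" and wv: "cross w v = 0"
    using uw vw cross_swap[of w u] cross_swap[of w v] by simp_all
  have "scale 2 (cross u (cross v x)) = 0"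
    using cross_cross_if_cross_eq_0[OF uv, of x] x cross_kernel_orthogonal(1)[OF u uv] by simp
  then have "cross u (cross v x) = 0" using two_neq_0 by simp
  then have "cross v x \<in> span {u, v, w}" using K by blast
  then have "cross w (cross v x) = 0"
    using span_minimal[OF _ subspace_cross_kernel[of w], of "{u, v, w}"] wu wv by auto
  then have "scale (2 * \<beta> w x) v = 0"
    using cross_cross_if_cross_eq_0[OF wv, of x] x
      cross_kernel_isotropic[OF u uw uv] by simp
  then show False using x two_neq_0 \<open>v \<noteq> 0\<close> by simp
qed

section \<open>Isotropic planes\<close>

text \<open>Multiples \<open>v\<close> of \<open>u\<close> need separate treatment: \<open>\<langle>u, v\<rangle>\<close> is then a line, which counts as
  isotropic only because \<open>u\<close> lies in an isotropic plane.\<close>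

lemma E_space_eq_cross_kernel:
  assumes u: "u \<noteq> 0" "gamma_isotropic_vector scale \<gamma> u"
  shows "E_space scale \<gamma> u = {v. cross u v = 0}"
proof (intro equalityI subsetI)
  fix v assume "v \<in> E_space scale \<gamma> u"
  then have "\<exists>P. span {u, v} \<subseteq> P \<and> (\<forall>a\<in>P. \<forall>b\<in>P. \<forall>c. \<gamma> a b c = 0)"
    unfolding E_space_def gamma_isotropic_def gamma_isotropic_plane_def mem_Collect_eq
    by (metis order_refl)
  moreover have "u \<in> span {u, v}" "v \<in> span {u, v}" by (simp_all add: span_base)
  ultimately show "v \<in> {v. cross u v = 0}" by (auto simp: cross_eq_0_iff)
next
  fix v assume v: "v \<in> {v. cross u v = 0}"
  show "v \<in> E_space scale \<gamma> u"
  proof (cases "v \<in> span {u}")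
    case True
    then have span: "span {u, v} = span {u}" by (metis insert_commute span_redundant)
    have "dim (span {u, v}) = 1" unfolding span using u(1) by simp
    moreover from u(2) obtain P where P: "gamma_isotropic_plane scale \<gamma> P" "u \<in> P"
      unfolding gamma_isotropic_vector_def by blast
    have "span {u, v} \<subseteq> P"
      unfolding span using P by (intro span_minimal) (auto simp: gamma_isotropic_plane_def)
    ultimately show ?thesis
      using P(1) unfolding E_space_def gamma_isotropic_def by blast
  next
    case False
    then have "independent (insert v {u})"
      using u(1) independent_insertI[of v "{u}"] by simp
    moreover have "v \<noteq> u" using False by (auto simp: span_base)
    ultimately have "dim (span {u, v}) = 2"
      by (simp add: insert_commute dim_eq_card_independent)
    moreover have "cross a b = 0" if "a \<in> span {u, v}" "b \<in> span {u, v}" for a b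
    proof (rule cross_eq_0_on_span[OF _ that])
      have "cross u v = 0" "cross v u = 0" using v cross_swap[of v u] by simp_all
      then show "cross c d = 0" if "c \<in> {u, v}" "d \<in> {u, v}" for c d
        using that by auto
    qed
    ultimately show ?thesis
      by (simp add: E_space_def gamma_isotropic_def cross_eq_0_iff)
  qed
qed

lemma null_if_gamma_isotropic_vector:
  assumes "gamma_isotropic_vector scale \<gamma> u"
  shows "\<beta> u u = 0"
proof -
  obtain P where P: "subspace P" "dim P = 2" "u \<in> P" "\<And>a b c. a \<in> P \<Longrightarrow> b \<in> P \<Longrightarrow> \<gamma> a b c = 0"
    using assms unfolding gamma_isotropic_vector_def gamma_isotropic_plane_def by blast
  have "\<not> P \<subseteq> span {u}" using dim_le_card[of P "{u}"] P(2) by auto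
  then obtain w where "w \<in> P" "w \<notin> span {u}" by blast
  then show ?thesis using null_if_cross_eq_0[of u w] P by (auto simp: cross_eq_0_iff)
qed

text \<open>Were \<open>u\<close> outside \<open>F\<close>, it would form, together with a basis \<open>v, w\<close> of \<open>F\<close>, a basis of
  the kernel.\<close>

lemma isotropic_plane_in_cross_kernel_contains:
  assumes u: "u \<noteq> 0" "\<beta> u u = 0" and three: "dim {v. cross u v = 0} \<le> 3"
    and F: "subspace F" "dim F = 2" "gamma_isotropic scale \<gamma> F" "F \<subseteq> {v. cross u v = 0}"
  shows "u \<in> F"
proof (rule ccontr)
  assume "u \<notin> F"
  obtain B where B: "B \<subseteq> F" "independent B" "F \<subseteq> span B" "card B = dim F"
    using basis_exists by blast
  then obtain v w where vw: "B = {v, w}" "v \<noteq> w" using F(2) by (metis card_2_iff)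
  have "F = span B" using B F(1) span_minimal by blast
  then have ind: "independent {u, v, w}" and uvw: "u \<noteq> v" "u \<noteq> w"
    using \<open>u \<notin> F\<close> B(1,2) independent_insertI[of u B] by (auto simp: vw)
  have "cross v w = 0"
    using F(2,3) B(1) by (auto simp: gamma_isotropic_def vw cross_eq_0_iff)
  moreover have "{v. cross u v = 0} \<subseteq> span {u, v, w}"
    by (rule card_ge_dim_independent) (use ind uvw vw three F(4) B(1) in auto)
  moreover have "v \<noteq> 0" using ind dependent_zero[of "{u, v, w}"] by auto
  moreover have "cross u v = 0" "cross u w = 0" using F(4) B(1) by (auto simp: vw)
  ultimately have "w \<in> span {u, v}"
    by (intro in_span_if_cross_vanishes_on_kernel[OF u])
  moreover have "{u, v, w} - {w} = {u, v}" using uvw vw by auto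
  ultimately show False using ind unfolding dependent_def by (metis insertI1 insertI2)
qed

end

theorem proposition2p2:
  fixes scale :: "'k::alg_closed_field \<Rightarrow> 'v::ab_group_add \<Rightarrow> 'v"
    and \<gamma> :: "'v \<Rightarrow> 'v \<Rightarrow> 'v \<Rightarrow> 'k"
    and \<beta> :: "'v \<Rightarrow> 'v \<Rightarrow> 'k"
    and u :: 'v
  assumes "CHAR('k) \<noteq> 2"
    and "vector_space scale"
    and "vector_space.dim scale (UNIV :: 'v set) = 7"
    and "alternating_trilinear_form scale \<gamma>"
    and "nondegenerate_trilinear_form scale \<gamma>"
    and "symmetric_bilinear_form scale \<beta>"
    and "nondegenerate_bilinear_form \<beta>"
    and "compatible_forms \<gamma> \<beta>"
    and "u \<noteq> 0"
    and "gamma_isotropic_vector scale \<gamma> u"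
  shows "module.subspace scale (E_space scale \<gamma> u) \<and>
         vector_space.dim scale (E_space scale \<gamma> u) = 3 \<and>
         beta_isotropic scale \<beta> (E_space scale \<gamma> u) \<and>
         (\<forall>F. module.subspace scale F \<and> vector_space.dim scale F = 2 \<and>
              gamma_isotropic scale \<gamma> F \<and> F \<subseteq> E_space scale \<gamma> u
              \<longrightarrow> u \<in> F)"
proof -
  interpret V: vector_space scale by (rule assms(2))
  obtain B where B: "V.independent B" "UNIV \<subseteq> V.span B" "card B = 7"
    using V.basis_exists[of UNIV] assms(3) by metis
  have "(2 :: 'k) \<noteq> 0"
    using assms(1) of_nat_eq_0_iff_char_dvd[where 'a = 'k, of 2] prime_nat_iff[of 2] CHAR_not_1
    by auto
  then interpret compatible_pair scale \<beta> B \<gamma>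
    using assms B card.infinite[of B] by unfold_locales auto
  note u = \<open>u \<noteq> 0\<close> null_if_gamma_isotropic_vector[OF assms(10)]
  have E: "E_space scale \<gamma> u = {v. cross u v = 0}"
    by (rule E_space_eq_cross_kernel) (use assms in auto)
  have dim: "V.dim {v. cross u v = 0} = 3"
    using dim_cross_kernel[OF u] assms(3) by simp
  show ?thesis
    unfolding E beta_isotropic_def
    using subspace_cross_kernel dim cross_kernel_isotropic[OF u]
      isotropic_plane_in_cross_kernel_contains[OF u] by auto
qed

end
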